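(* Let $\Omega\subset\mathbb{R}^k$ be a convex (open) subset, let $K=\mathbb{R}_+^{m\times n}$ be the cone of $m\times n$ matrices with nonnegative entries, and let $F:\Omega\to\mathbb{R}^{m\times n}$ be a Fréchet-differentiable strictly $K$-convex function. For $x,y\in\Omega$, let $(F^\star,x^\star,y^\star)$ be the Legendre transform of $(F,x,y)$. Then $$D_F(x,y)=D_{F^\star}(y^\star,x^\star).$$
   Context: $K$-order: $A\preceq_K B\iff B-A\in K$, $A\prec_K B\iff B-A\in\mathrm{int}(K)$. $F$ is strictly $K$-convex if $F(\theta x+(1-\theta)y)\prec_K\theta F(x)+(1-\theta)F(y)$ for all $x\neq y$ in $\Omega$, $\theta\in(0,1)$; for $K=\mathbb{R}_+^{m\times n}$ this means entrywise strict inequality. The generalized Bregman divergence of $F$ is $D_F(x,y):=F(x)-F(y)-DF(y)(x-y)$, where $DF(y)(\cdot)$ is the Fréchet derivative of $F$ at $y$. The Legendre transform of $(F,x,y)$ is understood entrywise: for each entry $F_{ij}:\Omega\to\mathbb{R}$, the Legendre transform is $F_{ij}^\star(p)=\sup_{u\in\Omega}\{\langle p,u\rangle-F_{ij}(u)\}$, and the dual points are $x^\star_{(ij)}=\nabla F_{ij}(x)$, $y^\star_{(ij)}=\nabla F_{ij}(y)\in\mathbb{R}^k$. The matrix $D_{F^\star}(y^\star,x^\star)$ has $(i,j)$ entry $$F_{ij}^\star(y^\star_{(ij)})-F_{ij}^\star(x^\star_{(ij)})-\big\langle\nabla F_{ij}^\star(x^\star_{(ij)}),\,y^\star_{(ij)}-x^\star_{(ij)}\big\rangle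 .$$ *)

theory Defs
  imports "HOL-Analysis.Analysis"
begin

definition cone_less :: "'v::euclidean_space set \<Rightarrow> 'v \<Rightarrow> 'v \<Rightarrow> bool" where
  "cone_less K A B \<longleftrightarrow> B - A \<in> interior K"

definition strictly_K_convex_on ::
    "'v::euclidean_space set \<Rightarrow> 'a::euclidean_space set \<Rightarrow> ('a \<Rightarrow> 'v) \<Rightarrow> bool" where
  "strictly_K_convex_on K \<Omega> F \<longleftrightarrow>
     (\<forall>x\<in>\<Omega>. \<forall>y\<in>\<Omega>. \<forall>\<theta>::real. x \<noteq> y \<longrightarrow> 0 < \<theta> \<longrightarrow> \<theta> < 1 \<longrightarrow>
        cone_less K (F (\<theta> *\<^sub>R x + (1 - \<theta>) *\<^sub>R y)) (\<theta> *\<^sub>R F x + (1 - \<theta>) *\<^sub>R F y))"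

(* An m x n matrix has type real^'n^'m: the row index 'm is the outer one. *)
definition nonneg_matrices :: "(real^'n^'m) set" where
  "nonneg_matrices = {A. \<forall>i j. 0 \<le> A $ i $ j}"

definition bregman :: "('a::euclidean_space \<Rightarrow> 'v::euclidean_space) \<Rightarrow> 'a \<Rightarrow> 'a \<Rightarrow> 'v" where
  "bregman F x y = F x - F y - frechet_derivative F (at y) (x - y)"

(* Meaningful only where f is differentiable; the gradient is then unique. *)
definition gradient :: "('a::euclidean_space \<Rightarrow> real) \<Rightarrow> 'a \<Rightarrow> 'a" where
  "gradient f x = (THE D. GDERIV f x :> D)"

definition conjugate ::
    "'a::euclidean_space set \<Rightarrow> ('a \<Rightarrow> real) \<Rightarrow> 'a \<Rightarrow> ereal" where
  "conjugate \<Omega> f p = (SUP u\<in>\<Omega>. ereal (p \<bullet> u - f u))"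

definition entry :: "('a \<Rightarrow> real^'n^'m) \<Rightarrow> 'm \<Rightarrow> 'n \<Rightarrow> 'a \<Rightarrow> real" where
  "entry F i j = (\<lambda>u. F u $ i $ j)"

(* real_of_ereal sends infinity to 0. This is harmless for the Bregman matrix below: when f is
   differentiable and strictly convex on a convex open set, its conjugate is finite in a
   neighbourhood of every dual point. *)
definition legendre_fun ::
    "'a::euclidean_space set \<Rightarrow> ('a \<Rightarrow> real^'n^'m) \<Rightarrow> 'm \<Rightarrow> 'n \<Rightarrow> 'a \<Rightarrow> real" where
  "legendre_fun \<Omega> F i j = (\<lambda>p. real_of_ereal (conjugate \<Omega> (entry F i j) p))"

definition legendre_point ::
    "('a::euclidean_space \<Rightarrow> real^'n^'m) \<Rightarrow> 'a \<Rightarrow> 'm \<Rightarrow> 'n \<Rightarrow> 'a" where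
  "legendre_point F x i j = gradient (entry F i j) x"

(* The dual points p i j and q i j vary with the entry, so this is not an instance of bregman. *)
definition bregman_entrywise ::
    "('m \<Rightarrow> 'n \<Rightarrow> 'a \<Rightarrow> real) \<Rightarrow> ('m \<Rightarrow> 'n \<Rightarrow> 'a) \<Rightarrow> ('m \<Rightarrow> 'n \<Rightarrow> 'a::euclidean_space) \<Rightarrow> real^'n^'m" where
  "bregman_entrywise G p q =
     (\<chi> i j. G i j (p i j) - G i j (q i j) - gradient (G i j) (q i j) \<bullet> (p i j - q i j))"

end

theory Submission
  imports Defs
begin

text \<open>
  Fix an entry \<open>f\<close>, a point \<open>x\<close> and \<open>p = \<nabla>f(x)\<close>. The gap \<open>g(u) = f(u) - f(x) - p \<bullet> (u - x)\<close> vanishes at \<open>x\<close>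
  and is positive elsewhere; if \<open>c > 0\<close> bounds it from below on a small sphere of radius \<open>r\<close> around \<open>x\<close>,
  convexity gives \<open>g(u) \<ge> (c / r) |u - x|\<close> outside that sphere. Hence for \<open>|h| \<le> c / r\<close> the supremum
  \<open>f\<^sup>\<star>(p + h) - f\<^sup>\<star>(p) - h \<bullet> x = sup (h \<bullet> (u - x) - g(u))\<close> lies between \<open>0\<close> and \<open>r |h|\<close>. As \<open>r\<close> is
  arbitrarily small, \<open>\<nabla>f\<^sup>\<star>(p) = x\<close>. Together with \<open>f\<^sup>\<star>(p) = p \<bullet> x - f(x)\<close> this turns the claim into an
  algebraic identity.
\<close>

section \<open>Strict convexity, from the matrix cone to its scalar entries\<close>

definition strictly_convex_on :: "'a::real_vector set \<Rightarrow> ('a \<Rightarrow> real) \<Rightarrow> bool" where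
  "strictly_convex_on S f \<longleftrightarrow>
     (\<forall>x\<in>S. \<forall>y\<in>S. \<forall>t. x \<noteq> y \<longrightarrow> 0 < t \<longrightarrow> t < 1 \<longrightarrow>
        f (t *\<^sub>R x + (1 - t) *\<^sub>R y) < t * f x + (1 - t) * f y)"

lemma strictly_convex_onD:
  assumes "strictly_convex_on S f" "x \<in> S" "y \<in> S" "x \<noteq> y" "0 < t" "t < 1"
  shows "f (t *\<^sub>R x + (1 - t) *\<^sub>R y) < t * f x + (1 - t) * f y"
  using assms unfolding strictly_convex_on_def by blast

lemma strictly_convex_on_imp_convex_on:
  assumes "strictly_convex_on S f" "convex S"
  shows "convex_on S f"
proof (rule convex_onI)
  fix t :: real and x y assume t: "0 < t" "t < 1" and xy: "x \<in> S" "y \<in> S"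
  show "f ((1 - t) *\<^sub>R x + t *\<^sub>R y) \<le> (1 - t) * f x + t * f y"
  proof (cases "x = y")
    case True
    then show ?thesis by (simp add: algebra_simps flip: scaleR_add_left)
  next
    case False
    \<comment> \<open>In \<open>convex_onI\<close> the weight \<open>t\<close> sits on the second
      point, so the strict inequality is taken with the two points exchanged.\<close>
    then show ?thesis
      using strictly_convex_onD[OF assms(1) xy(2,1), of t] t by (auto simp: add.commute)
  qed
qed (use assms in auto)

text \<open>The cone lies in the closed half-space on which entry \<open>(i, j)\<close>, the inner
  product with the matrix unit \<open>?E\<close>, is nonnegative. Interiors are monotone, and the
  interior of that half-space is the open one.\<close>

lemma nonneg_matrices_interior_pos:
  assumes "A \<in> interior (nonneg_matrices :: (real^'n^'m) set)"
  shows "0 < A $ i $ j"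
proof -
  let ?E = "axis i (axis j 1) :: real^'n^'m"
  have "nonneg_matrices \<subseteq> {A. ?E \<bullet> A \<ge> 0}"
    by (auto simp: nonneg_matrices_def inner_axis')
  then have "A \<in> interior {A. ?E \<bullet> A \<ge> 0}"
    using assms interior_mono by blast
  moreover have "?E \<noteq> 0" by simp
  ultimately have "?E \<bullet> A > 0" by (simp add: interior_halfspace_ge)
  then show ?thesis by (simp add: inner_axis')
qed

lemma strictly_K_convex_on_entry:
  assumes "strictly_K_convex_on nonneg_matrices \<Omega> F"
  shows "strictly_convex_on \<Omega> (entry F i j)"
  unfolding strictly_convex_on_def
proof (intro ballI allI impI)
  fix x y t assume "x \<in> \<Omega>" "y \<in> \<Omega>" "x \<noteq> y" "0 < t" "t < (1::real)"
  then have "t *\<^sub>R F x + (1 - t) *\<^sub>R F y - F (t *\<^sub>R x + (1 - t) *\<^sub>R y) \<in> interior nonneg_matrices"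
    using assms unfolding strictly_K_convex_on_def cone_less_def by blast
  from nonneg_matrices_interior_pos[OF this, of i j]
  show "entry F i j (t *\<^sub>R x + (1 - t) *\<^sub>R y) < t * entry F i j x + (1 - t) * entry F i j y"
    by (simp add: entry_def)
qed

section \<open>Gradients and their relation to the matrix derivative\<close>

lemma GDERIV_uniq:
  assumes "GDERIV f x :> D" "GDERIV f x :> D'"
  shows "D = D'"
proof -
  have "(\<lambda>h. h \<bullet> D) = (\<lambda>h. h \<bullet> D')"
    using assms unfolding gderiv_def by (rule has_derivative_unique)
  then show ?thesis by (metis vector_eq_rdot inner_commute)
qed

lemma gradient_eqI: "GDERIV f x :> D \<Longrightarrow> gradient f x = D"
  unfolding gradient_def using GDERIV_uniq by blast

text \<open>Riesz representation: \<open>f' h = f' h * 1 = h \<bullet> adjoint f' 1\<close>, so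
  \<open>adjoint f' 1\<close> is the vector representing the functional \<open>f'\<close>.\<close>

lemma has_derivative_imp_GDERIV:
  fixes f :: "'a::euclidean_space \<Rightarrow> real"
  assumes "(f has_derivative f') (at x)"
  shows "GDERIV f x :> adjoint f' 1"
proof -
  have "linear f'" using assms has_derivative_linear by blast
  then have "f' = (\<lambda>h. h \<bullet> adjoint f' 1)" by (simp add: adjoint_works)
  then show ?thesis using assms unfolding gderiv_def by metis
qed

text \<open>Taking an entry is a bounded linear map, so it commutes with differentiation; uniqueness
  of derivatives then identifies the entry of the matrix derivative with the inner product with the
  gradient.\<close>

lemma GDERIV_entry:
  assumes "F differentiable (at x)"
  shows "GDERIV (entry F i j) x :> gradient (entry F i j) x"
    and "frechet_derivative F (at x) h $ i $ j = h \<bullet> gradient (entry F i j) x"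
proof -
  have "(F has_derivative frechet_derivative F (at x)) (at x)"
    using assms frechet_derivative_works by blast
  then have D: "(entry F i j has_derivative (\<lambda>h. frechet_derivative F (at x) h $ i $ j)) (at x)"
    unfolding entry_def
    by (intro bounded_linear.has_derivative[OF bounded_linear_vec_nth])
  from has_derivative_imp_GDERIV[OF this]
  show G: "GDERIV (entry F i j) x :> gradient (entry F i j) x"
    using gradient_eqI by metis
  show "frechet_derivative F (at x) h $ i $ j = h \<bullet> gradient (entry F i j) x"
    using has_derivative_unique[OF D G[unfolded gderiv_def]] by meson
qed

section \<open>Tangent inequalities and growth of the tangent gap\<close>

lemma convex_on_above_tangent_GDERIV:
  fixes f :: "'a::euclidean_space \<Rightarrow> real"
  assumes "convex_on S f" "open S" "GDERIV f x :> p" "x \<in> S" "u \<in> S"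
  shows "f u - f x \<ge> p \<bullet> (u - x)"
proof -
  \<comment> \<open>Restricting \<open>f\<close> to the line through \<open>x\<close> and
    \<open>u\<close> reduces the claim to the one-dimensional tangent inequality, applied between
    the parameters 0 and 1.\<close>
  define l where "l = (\<lambda>t::real. x + t *\<^sub>R (u - x))"
  define A where "A = l -` S"
  have "convex S" using assms(1) convex_on_imp_convex by blast
  have aff: "l ((1 - t) *\<^sub>R a + t *\<^sub>R b) = (1 - t) *\<^sub>R l a + t *\<^sub>R l b" for a b t
    by (simp add: l_def algebra_simps)
  have "convex A"
    unfolding convex_alt A_def
    using \<open>convex S\<close> by (auto simp: convex_alt aff simp del: real_scaleR_def)
  have "open A"
    unfolding A_def l_def by (intro open_vimage assms continuous_intros)
  have "convex_on A (f \<circ> l)"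
  proof (rule convex_onI)
    fix t a b assume "0 < t" "t < (1::real)" "a \<in> A" "b \<in> A"
    then show "(f \<circ> l) ((1 - t) *\<^sub>R a + t *\<^sub>R b) \<le> (1 - t) * (f \<circ> l) a + t * (f \<circ> l) b"
      using convex_onD[OF assms(1), of t "l a" "l b"] by (simp add: aff A_def del: real_scaleR_def)
  qed fact
  moreover have "((f \<circ> l) has_field_derivative p \<bullet> (u - x)) (at 0 within A)"
  proof -
    have "(l has_derivative (\<lambda>t. t *\<^sub>R (u - x))) (at 0)"
      unfolding l_def by (auto intro!: derivative_eq_intros)
    moreover have "(f has_derivative (\<lambda>h. h \<bullet> p)) (at (l 0))"
      using assms(3) by (simp add: l_def gderiv_def)
    ultimately have "((f \<circ> l) has_derivative (\<lambda>t. (t *\<^sub>R (u - x)) \<bullet> p)) (at 0)"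
      using diff_chain_at by (fastforce simp: o_def)
    then have "((f \<circ> l) has_derivative (*) (p \<bullet> (u - x))) (at 0)"
      by (rule has_derivative_eq_rhs) (auto simp: inner_commute)
    then show ?thesis
      by (simp add: has_field_derivative_def has_derivative_at_withinI)
  qed
  moreover have "0 \<in> A" "1 \<in> A" using assms by (auto simp: A_def l_def)
  moreover have "connected A" using \<open>convex A\<close> convex_connected by blast
  moreover have "0 \<in> interior A" using \<open>open A\<close> \<open>0 \<in> A\<close> interior_open by blast
  ultimately have "(f \<circ> l) 1 - (f \<circ> l) 0 \<ge> p \<bullet> (u - x) * (1 - 0)"
    by (intro convex_on_imp_above_tangent)
  then show ?thesis by (simp add: l_def)
qed

text \<open>At the midpoint \<open>?w\<close> the weak tangent inequality bounds
  \<open>f ?w - f x\<close> below by half of \<open>p \<bullet> (u - x)\<close>, while strict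
  convexity bounds it strictly above by half of \<open>f u - f x\<close>.\<close>

lemma strictly_convex_on_above_tangent:
  fixes f :: "'a::euclidean_space \<Rightarrow> real"
  assumes "strictly_convex_on S f" "convex S" "open S" "GDERIV f x :> p"
    and "x \<in> S" "u \<in> S" "u \<noteq> x"
  shows "f u - f x > p \<bullet> (u - x)"
proof -
  let ?w = "(1/2) *\<^sub>R u + (1 - 1/2) *\<^sub>R x"
  have "?w \<in> S" using assms convexD[of S u x "1/2" "1/2"] by simp
  then have "f ?w - f x \<ge> p \<bullet> (?w - x)"
    using convex_on_above_tangent_GDERIV strictly_convex_on_imp_convex_on assms by blast
  moreover have "?w - x = (1/2) *\<^sub>R (u - x)"
    by (simp add: algebra_simps flip: scaleR_add_left)
  moreover have "f ?w < 1/2 * f u + (1 - 1/2) * f x"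
    using assms by (intro strictly_convex_onD) auto
  ultimately show ?thesis by simp
qed

text \<open>Compactness of the sphere gives a positive minimum \<open>g z\<close> of the gap.
  Convexity along rays from \<open>x\<close>, where the gap vanishes, spreads it outward at slope
  \<open>g z / r\<close>.\<close>

lemma strictly_convex_on_tangent_gap_growth:
  fixes f :: "'a::euclidean_space \<Rightarrow> real"
  assumes f: "strictly_convex_on S f" "convex S" "open S" "continuous_on S f" "GDERIV f x :> p" "x \<in> S"
    and r: "0 < r" "cball x r \<subseteq> S"
  obtains d where "0 < d"
    "\<And>u. u \<in> S \<Longrightarrow> r \<le> norm (u - x) \<Longrightarrow> d * norm (u - x) \<le> f u - f x - p \<bullet> (u - x)"
proof -
  define g where "g u = f u - f x - p \<bullet> (u - x)" for u
  have "continuous_on (sphere x r) g"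
    unfolding g_def using r f(4)
    by (intro continuous_intros) (meson continuous_on_subset sphere_cball order_trans)
  moreover have "sphere x r \<noteq> {}" using r by simp
  ultimately obtain z where z: "z \<in> sphere x r" "\<And>v. v \<in> sphere x r \<Longrightarrow> g z \<le> g v"
    using continuous_attains_inf[of "sphere x r" g] by auto
  have "z \<in> S" "z \<noteq> x" using z r by auto
  then have "g z > 0"
    using strictly_convex_on_above_tangent[OF f(1,2,3,5,6), of z] by (simp add: g_def)
  show ?thesis
  proof
    show "0 < g z / r" using \<open>g z > 0\<close> r by simp
    fix u assume u: "u \<in> S" "r \<le> norm (u - x)"
    \<comment> \<open>With this ratio, the point \<open>v\<close> below is where the segment from
      \<open>x\<close> to \<open>u\<close> meets the sphere.\<close>
    define t where "t = r / norm (u - x)"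
    have nz: "norm (u - x) > 0" using u r by linarith
    have t: "0 < t" "t \<le> 1" using u r nz by (auto simp: t_def)
    define v where "v = (1 - t) *\<^sub>R x + t *\<^sub>R u"
    have vx: "v - x = t *\<^sub>R (u - x)" by (simp add: v_def algebra_simps)
    have "norm (v - x) = r" using nz r by (simp add: vx t_def)
    then have "g z \<le> g v" by (intro z) (simp add: dist_norm norm_minus_commute)
    also have "f v \<le> (1 - t) * f x + t * f u"
      unfolding v_def using strictly_convex_on_imp_convex_on[OF f(1,2)] t u f(6)
      by (intro convex_onD) auto
    then have "g v \<le> t * g u" by (simp add: g_def vx algebra_simps)
    finally show "g z / r * norm (u - x) \<le> f u - f x - p \<bullet> (u - x)"
      using r nz by (simp add: t_def flip: g_def) (simp add: field_simps)
  qed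
qed

section \<open>The conjugate and its gradient at a dual point\<close>

lemma conjugate_eqI:
  assumes "x \<in> S" "\<And>u. u \<in> S \<Longrightarrow> p \<bullet> (u - x) \<le> f u - f x"
  shows "conjugate S f p = ereal (p \<bullet> x - f x)"
  unfolding conjugate_def
proof (rule SUP_eqI)
  show "ereal (p \<bullet> u - f u) \<le> ereal (p \<bullet> x - f x)" if "u \<in> S" for u
    using assms(2)[OF that] by (simp add: inner_diff_right)
qed (use assms(1) in blast)

text \<open>The remainder is the supremum of \<open>(q - p) \<bullet> (u - x)\<close> minus the gap
  at \<open>u\<close>. The choice \<open>u = x\<close> gives the lower bound. For the upper one, the
  growth of the gap absorbs the linear term when \<open>u\<close> is at least \<open>r\<close> away
  from \<open>x\<close>; nearer points are handled by Cauchy-Schwarz and nonnegativity of the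
  gap.\<close>

lemma conjugate_remainder_bounds:
  assumes "x \<in> S"
    and gap: "\<And>u. u \<in> S \<Longrightarrow> p \<bullet> (u - x) \<le> f u - f x"
    and growth: "\<And>u. u \<in> S \<Longrightarrow> r \<le> norm (u - x) \<Longrightarrow> d * norm (u - x) \<le> f u - f x - p \<bullet> (u - x)"
    and "0 < r" "norm (q - p) \<le> d"
  shows "0 \<le> real_of_ereal (conjugate S f q) - (p \<bullet> x - f x) - (q - p) \<bullet> x"
    and "real_of_ereal (conjugate S f q) - (p \<bullet> x - f x) - (q - p) \<bullet> x \<le> r * norm (q - p)"
proof -
  have "q \<bullet> u - f u \<le> q \<bullet> x - f x + r * norm (q - p)" if u: "u \<in> S" for u
  proof -
    have cs: "(q - p) \<bullet> (u - x) \<le> norm (q - p) * norm (u - x)" by (rule norm_cauchy_schwarz)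
    have "(q - p) \<bullet> (u - x) - (f u - f x - p \<bullet> (u - x)) \<le> r * norm (q - p)"
    proof (cases "r \<le> norm (u - x)")
      case True
      have "norm (q - p) * norm (u - x) \<le> d * norm (u - x)"
        using assms(5) by (intro mult_right_mono) auto
      with cs growth[OF u True] have "(q - p) \<bullet> (u - x) - (f u - f x - p \<bullet> (u - x)) \<le> 0"
        by linarith
      also have "0 \<le> r * norm (q - p)" using \<open>0 < r\<close> by simp
      finally show ?thesis .
    next
      case False
      then have "norm (q - p) * norm (u - x) \<le> norm (q - p) * r"
        by (intro mult_left_mono) auto
      with cs gap[OF u] show ?thesis by (simp add: mult.commute)
    qed
    then show ?thesis by (simp add: inner_diff_left inner_diff_right)
  qed
  then have "conjugate S f q \<le> ereal (q \<bullet> x - f x + r * norm (q - p))"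
    unfolding conjugate_def by (auto intro: SUP_least)
  moreover have "ereal (q \<bullet> x - f x) \<le> conjugate S f q"
    unfolding conjugate_def using assms(1) by (intro SUP_upper)
  \<comment> \<open>Both bounds are real, so the conjugate is finite at \<open>q\<close> and
    \<open>real_of_ereal\<close> does not fall back on its value 0 at infinity.\<close>
  ultimately show "0 \<le> real_of_ereal (conjugate S f q) - (p \<bullet> x - f x) - (q - p) \<bullet> x"
    and "real_of_ereal (conjugate S f q) - (p \<bullet> x - f x) - (q - p) \<bullet> x \<le> r * norm (q - p)"
    by (cases "conjugate S f q"; simp add: inner_diff_left)+
qed

lemma GDERIV_conjugate:
  fixes f :: "'a::euclidean_space \<Rightarrow> real"
  assumes f: "strictly_convex_on S f" "convex S" "open S" "continuous_on S f" "GDERIV f x :> p" "x \<in> S"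
  shows "GDERIV (\<lambda>q. real_of_ereal (conjugate S f q)) p :> x"
proof -
  let ?G = "\<lambda>q. real_of_ereal (conjugate S f q)"
  have gap: "p \<bullet> (u - x) \<le> f u - f x" if "u \<in> S" for u
    using convex_on_above_tangent_GDERIV strictly_convex_on_imp_convex_on f that by blast
  have Gp: "?G p = p \<bullet> x - f x" using conjugate_eqI[OF f(6) gap] by simp
  have "\<exists>d>0. \<forall>q. norm (q - p) < d \<longrightarrow> norm (?G q - ?G p - (q - p) \<bullet> x) \<le> e * norm (q - p)"
    if "e > 0" for e
  proof -
    obtain r0 where r0: "r0 > 0" "cball x r0 \<subseteq> S"
      using f(3,6) open_contains_cball by blast
    \<comment> \<open>The radius must keep the ball inside \<open>S\<close> and also serve as the
      remainder's factor, hence be at most \<open>e\<close>.\<close>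
    define r where "r = min e r0"
    have r: "0 < r" "cball x r \<subseteq> S" "r \<le> e"
      using r0 that by (auto simp: r_def)
    obtain d where d: "0 < d"
      "\<And>u. u \<in> S \<Longrightarrow> r \<le> norm (u - x) \<Longrightarrow> d * norm (u - x) \<le> f u - f x - p \<bullet> (u - x)"
      using strictly_convex_on_tangent_gap_growth[OF f r(1,2)] by metis
    have "norm (?G q - ?G p - (q - p) \<bullet> x) \<le> e * norm (q - p)" if "norm (q - p) < d" for q
    proof -
      have "norm (?G q - ?G p - (q - p) \<bullet> x) \<le> r * norm (q - p)"
        using conjugate_remainder_bounds[OF f(6) gap d(2) r(1), of q] that by (simp add: Gp)
      also have "\<dots> \<le> e * norm (q - p)" using r by (intro mult_right_mono) auto
      finally show ?thesis .
    qed
    with d(1) show ?thesis by blast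
  qed
  then show ?thesis
    unfolding gderiv_def has_derivative_at_alt by (auto intro: bounded_linear_inner_left)
qed

theorem theorem3:
  fixes \<Omega> :: "(real^'k) set"
    and F :: "real^'k \<Rightarrow> real^'n^'m"
    and x y :: "real^'k"
  assumes "open \<Omega>" and "convex \<Omega>"
    and "F differentiable_on \<Omega>"
    and "strictly_K_convex_on nonneg_matrices \<Omega> F"
    and "x \<in> \<Omega>" and "y \<in> \<Omega>"
  shows "bregman F x y =
    bregman_entrywise (legendre_fun \<Omega> F) (legendre_point F y) (legendre_point F x)"
proof -
  have diff: "F differentiable (at z)" if "z \<in> \<Omega>" for z
    using assms(1,3) that differentiable_on_eq_differentiable_at by blast
  have "bregman F x y $ i $ j =
    bregman_entrywise (legendre_fun \<Omega> F) (legendre_point F y) (legendre_point F x) $ i $ j" for i j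
  proof -
    let ?f = "entry F i j"
    have sc: "strictly_convex_on \<Omega> ?f" using assms(4) by (rule strictly_K_convex_on_entry)
    have grad: "GDERIV ?f z :> legendre_point F z i j" if "z \<in> \<Omega>" for z
      using GDERIV_entry(1)[OF diff[OF that]] by (simp add: legendre_point_def)
    have cont: "continuous_on \<Omega> ?f"
      unfolding entry_def using assms(3)
      by (intro continuous_intros differentiable_imp_continuous_on)
    have value_at: "legendre_fun \<Omega> F i j (legendre_point F z i j) = legendre_point F z i j \<bullet> z - ?f z"
      if "z \<in> \<Omega>" for z
    proof -
      have "legendre_point F z i j \<bullet> (u - z) \<le> ?f u - ?f z" if "u \<in> \<Omega>" for u
        using convex_on_above_tangent_GDERIV[OF strictly_convex_on_imp_convex_on[OF sc assms(2)]
            assms(1) grad] that \<open>z \<in> \<Omega>\<close> by blast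
      from conjugate_eqI[OF \<open>z \<in> \<Omega>\<close> this] show ?thesis by (simp add: legendre_fun_def)
    qed
    \<comment> \<open>Differentiating the conjugate inverts the gradient map: the dual point of
      \<open>x\<close> is sent back to \<open>x\<close>.\<close>
    have "gradient (legendre_fun \<Omega> F i j) (legendre_point F x i j) = x"
      unfolding legendre_fun_def
      by (intro gradient_eqI GDERIV_conjugate sc cont grad assms)
    moreover have "frechet_derivative F (at y) (x - y) $ i $ j = (x - y) \<bullet> legendre_point F y i j"
      using GDERIV_entry(2)[OF diff[OF assms(6)]] by (simp add: legendre_point_def)
    \<comment> \<open>Writing \<open>p\<close> and \<open>q\<close> for the dual points of
      \<open>y\<close> and \<open>x\<close>, the right side is \<open>(p \<bullet> y - ?f y) - (q
      \<bullet> x - ?f x) - x \<bullet> (p - q)\<close>. The terms in \<open>q\<close> cancel,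
      leaving \<open>?f x - ?f y - p \<bullet> (x - y)\<close>.\<close>
    ultimately show ?thesis
      by (simp add: bregman_def bregman_entrywise_def value_at assms(5,6) entry_def
          inner_diff_left inner_diff_right inner_commute)
  qed
  then show ?thesis by (simp add: vec_eq_iff)
qed

end
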